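(* Let $\mathcal H$ be a class of Boolean functions on $\{0,1\}^n$, and suppose that $\mathcal H$ has an $(\epsilon,\delta)$-distance estimator $D$ with query complexity $q=q(\epsilon,\delta)$. Then $\mathcal H$ is $(\epsilon,\delta)$-PAC-verifiable (with respect to the uniform distribution) by a protocol in which the verifier makes $q(\epsilon/6,\delta/2)$ membership queries to the input $f:\{0,1\}^n\to\{0,1\}$, the communication complexity is $\log(|\mathcal H|)$, the interaction consists only of a proof (a single message from the prover), the verifier's running time is $T_D(\epsilon/6,\delta/2)+T_{\mathrm{dist}}(\epsilon/6,\delta/2)$, and the honest prover merely runs a learning algorithm for $\mathcal H$ and sends its output. Here $T_D$ is the time to run $D$ with parameters $(\epsilon/6,\delta/2)$ and $T_{\mathrm{dist}}$ is the time to estimate the distance between the input and a hypothesis (to accuracy $\epsilon/6$ with confidence $1-\delta/2$). The interaction outputs $h\in\mathcal H\cup\{\bot\}$ such that: (Completeness) there exists an honest prover $P^*$ such that the output $h$ satisfies $\Pr[\mathsf{dist}(f,h)\le\mathsf{dist}(f,\mathcal H)+\epsilon/3]\ge1-\delta$; (Soundness) for every (possibly unbounded) prover $P$, the output $h$ satisfies $\Pr[(h\neq\bot)\wedge(\mathsf{dist}(h,f)>\mathsf{dist}(\mathcal H,f)+\epsilon)]<\delta$.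
   Context: $\mathsf{dist}(f,g)=\Pr_{x}[f(x)\neq g(x)]$ for $x$ uniform in $\{0,1\}^n$, and $\mathsf{dist}(f,\mathcal H)=\min_{g\in\mathcal H}\mathsf{dist}(f,g)$. For $\epsilon,\delta>0$, an $(\epsilon,\delta)$-distance estimator for $\mathcal H$ is an algorithm that, given oracle (membership query) access to $f:\{0,1\}^n\to\{0,1\}$, outputs $\tilde d\in[0,1]$ with $\Pr[|\mathsf{dist}(f,\mathcal H)-\tilde d|>\epsilon]<\delta$; its query complexity is the maximum number of queries it makes to $f$. A class $\mathcal H$ is $(\epsilon,\delta)$-PAC-verifiable if there is an interactive protocol between verifier $V$ and prover $P$ on inputs $1^n,\epsilon,\delta$ with oracle access to $f$, where $V$ outputs a hypothesis in $\mathcal H$ or $\bot$, satisfying completeness and soundness guarantees of the form stated. Probabilities are over the parties' randomness and samples.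
   Formalization: The verifier's running time is T_D + T_dist plus an absolute constant, as the exact sum leaves no step to compare the estimates; log|H| is rounded up; the procedure timed by T_dist is given and uses random labelled examples, not membership queries; the honest prover's learner never fails. *)

theory Defs
  imports "HOL-Probability.Probability"
begin

section \<open>Boolean functions and distances\<close>

definition cube :: "nat \<Rightarrow> bool list set" where
  "cube n = {x. length x = n}"

text \<open>Functions are extensional, so that distinct elements of a class differ on the cube
  and the cardinality of a class is the intended one.\<close>
definition bool_funs :: "nat \<Rightarrow> (bool list \<Rightarrow> bool) set" where
  "bool_funs n = (cube n \<rightarrow>\<^sub>E UNIV)"

definition fdist :: "nat \<Rightarrow> (bool list \<Rightarrow> bool) \<Rightarrow> (bool list \<Rightarrow> bool) \<Rightarrow> real" where
  "fdist n f g = measure_pmf.prob (pmf_of_set (cube n)) {x. f x \<noteq> g x}"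

definition class_dist :: "nat \<Rightarrow> (bool list \<Rightarrow> bool) \<Rightarrow> (bool list \<Rightarrow> bool) set \<Rightarrow> real" where
  "class_dist n f H = Min (fdist n f ` H)"

section \<open>Randomized oracle algorithms\<close>

text \<open>
  Algorithms are programs for a real RAM: registers hold real numbers, each instruction performs
  one operation and takes one step. The memory consists of infinitely many named arrays
  \<open>M a\<close>, of which a program mentions finitely many; \<open>Ind a b j\<close> is the cell of array \<open>a\<close> whose
  index is stored in cell \<open>j\<close> of array \<open>b\<close>. Programs have access to
  \<^item> fair coins (\<open>Flip\<close>),
  \<^item> membership queries to \<open>f\<close> (\<open>Query\<close>, at the point stored as bits in an array),
  \<^item> uniformly random labelled examples of \<open>f\<close> (\<open>Sample\<close>),
  \<^item> a read-only tape containing a received message (\<open>ReadMsg\<close>).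
  Only membership queries count towards the query complexity. An oracle access takes one step,
  including the transfer of the \<open>n\<close>-bit point. Any nonzero register represents the bit 1.
\<close>

datatype addr = Dir nat nat | Ind nat nat nat

datatype arith_op = Add | Sub | Mult | Div

datatype prog =
    Skip
  | Const addr int
  | Arith arith_op addr addr addr
  | Flip addr
  | Query addr nat
  | Sample addr nat
  | ReadMsg addr addr
  | Seq prog prog
  | IfLe addr addr prog prog
  | WhileLe addr addr prog

type_synonym mem = "nat \<Rightarrow> nat \<Rightarrow> real"

fun cell :: "mem \<Rightarrow> addr \<Rightarrow> nat \<times> nat" where
  "cell M (Dir a i) = (a, i)"
| "cell M (Ind a b j) = (a, nat \<lfloor>M b j\<rfloor>)"

definition get :: "mem \<Rightarrow> addr \<Rightarrow> real" where
  "get M p = (case cell M p of (a, i) \<Rightarrow> M a i)"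

definition put :: "addr \<Rightarrow> real \<Rightarrow> mem \<Rightarrow> mem" where
  "put p v M = (case cell M p of (a, i) \<Rightarrow> M(a := (M a)(i := v)))"

definition read_bits :: "nat \<Rightarrow> (nat \<Rightarrow> real) \<Rightarrow> bool list" where
  "read_bits k A = map (\<lambda>i. A i \<noteq> 0) [0..<k]"

definition write_bits :: "bool list \<Rightarrow> (nat \<Rightarrow> real) \<Rightarrow> nat \<Rightarrow> real" where
  "write_bits x A = (\<lambda>i. if i < length x then of_bool (x ! i) else A i)"

fun arith :: "arith_op \<Rightarrow> real \<Rightarrow> real \<Rightarrow> real" where
  "arith Add x y = x + y"
| "arith Sub x y = x - y"
| "arith Mult x y = x * y"
| "arith Div x y = x / y"

text \<open>A configuration \<open>(c, M, k)\<close> consists of the remaining program, the memory and the number of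
  membership queries made so far; it is halted if \<open>c = Skip\<close>. The parameters of \<open>step\<close> are the
  dimension, the oracle function and the content of the message tape.\<close>

type_synonym config = "prog \<times> mem \<times> nat"

primrec step ::
  "nat \<Rightarrow> (bool list \<Rightarrow> bool) \<Rightarrow> bool list \<Rightarrow> prog \<Rightarrow> mem \<Rightarrow> nat \<Rightarrow> config pmf" where
  "step n f m Skip M k = return_pmf (Skip, M, k)"
| "step n f m (Const p v) M k = return_pmf (Skip, put p (of_int v) M, k)"
| "step n f m (Arith g p r s) M k =
     return_pmf (Skip, put p (arith g (get M r) (get M s)) M, k)"
| "step n f m (Flip p) M k =
     map_pmf (\<lambda>b. (Skip, put p (of_bool b) M, k)) (bernoulli_pmf (1 / 2))"
| "step n f m (Query p a) M k =
     return_pmf (Skip, put p (of_bool (f (read_bits n (M a)))) M, Suc k)"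
| "step n f m (Sample p a) M k =
     map_pmf (\<lambda>x. (Skip, put p (of_bool (f x)) (M(a := write_bits x (M a))), k))
       (pmf_of_set (cube n))"
| "step n f m (ReadMsg p r) M k =
     (let i = nat \<lfloor>get M r\<rfloor>
      in return_pmf (Skip, put p (of_bool (i < length m \<and> m ! i)) M, k))"
| "step n f m (Seq c1 c2) M k =
     (if c1 = Skip then return_pmf (c2, M, k)
      else map_pmf (\<lambda>(c, M', k'). (Seq c c2, M', k')) (step n f m c1 M k))"
| "step n f m (IfLe r s c1 c2) M k =
     return_pmf (if get M r \<le> get M s then c1 else c2, M, k)"
| "step n f m (WhileLe r s c) M k =
     return_pmf (if get M r \<le> get M s then Seq c (WhileLe r s c) else Skip, M, k)"

text \<open>The inputs (the dimension, an accuracy and a confidence parameter) are in array 0;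
  all other cells are 0 initially.\<close>
definition init_mem :: "nat \<Rightarrow> real \<Rightarrow> real \<Rightarrow> mem" where
  "init_mem n \<epsilon> \<delta> = (\<lambda>_ _. 0)(0 := (\<lambda>_. 0)(0 := real n, 1 := \<epsilon>, 2 := \<delta>))"

primrec run :: "nat \<Rightarrow> (bool list \<Rightarrow> bool) \<Rightarrow> bool list \<Rightarrow> real \<Rightarrow> real \<Rightarrow> prog \<Rightarrow> nat \<Rightarrow> config pmf"
  where
  "run n f m \<epsilon> \<delta> c 0 = return_pmf (c, init_mem n \<epsilon> \<delta>, 0)"
| "run n f m \<epsilon> \<delta> c (Suc t) = bind_pmf (run n f m \<epsilon> \<delta> c t) (\<lambda>(c', M, k). step n f m c' M k)"

definition halts_within ::
  "nat \<Rightarrow> (bool list \<Rightarrow> bool) \<Rightarrow> bool list \<Rightarrow> real \<Rightarrow> real \<Rightarrow> prog \<Rightarrow> nat \<Rightarrow> bool" where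
  "halts_within n f m \<epsilon> \<delta> c t \<longleftrightarrow> (\<forall>(c', M, k) \<in> set_pmf (run n f m \<epsilon> \<delta> c t). c' = Skip)"

definition halts :: "nat \<Rightarrow> (bool list \<Rightarrow> bool) \<Rightarrow> bool list \<Rightarrow> real \<Rightarrow> real \<Rightarrow> prog \<Rightarrow> bool" where
  "halts n f m \<epsilon> \<delta> c \<longleftrightarrow> (\<exists>t. halts_within n f m \<epsilon> \<delta> c t)"

text \<open>The output is array 1 of the final memory. This is meaningful only for programs that
  halt; halted configurations do not change, so any later time gives the same distribution.\<close>
definition output_of ::
  "nat \<Rightarrow> (bool list \<Rightarrow> bool) \<Rightarrow> bool list \<Rightarrow> real \<Rightarrow> real \<Rightarrow> prog \<Rightarrow> (nat \<Rightarrow> real) pmf" where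
  "output_of n f m \<epsilon> \<delta> c =
     map_pmf (\<lambda>(_, M, _). M 1) (run n f m \<epsilon> \<delta> c (LEAST t. halts_within n f m \<epsilon> \<delta> c t))"

text \<open>Worst-case resource bounds over all functions \<open>f\<close>, all messages from a given set, and all
  random choices.\<close>

definition time_le :: "nat \<Rightarrow> bool list set \<Rightarrow> real \<Rightarrow> real \<Rightarrow> prog \<Rightarrow> nat \<Rightarrow> bool" where
  "time_le n ms \<epsilon> \<delta> c T \<longleftrightarrow> (\<forall>f\<in>bool_funs n. \<forall>m\<in>ms. halts_within n f m \<epsilon> \<delta> c T)"

definition queries_le :: "nat \<Rightarrow> bool list set \<Rightarrow> real \<Rightarrow> real \<Rightarrow> prog \<Rightarrow> nat \<Rightarrow> bool" where
  "queries_le n ms \<epsilon> \<delta> c q \<longleftrightarrow>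
     (\<forall>f\<in>bool_funs n. \<forall>m\<in>ms. \<forall>t. \<forall>(c', M, k) \<in> set_pmf (run n f m \<epsilon> \<delta> c t). k \<le> q)"

primrec uses_query :: "prog \<Rightarrow> bool" where
  "uses_query Skip = False"
| "uses_query (Const p v) = False"
| "uses_query (Arith g p r s) = False"
| "uses_query (Flip p) = False"
| "uses_query (Query p a) = True"
| "uses_query (Sample p a) = False"
| "uses_query (ReadMsg p r) = False"
| "uses_query (Seq c1 c2) = (uses_query c1 \<or> uses_query c2)"
| "uses_query (IfLe r s c1 c2) = (uses_query c1 \<or> uses_query c2)"
| "uses_query (WhileLe r s c) = uses_query c"

primrec uses_sample :: "prog \<Rightarrow> bool" where
  "uses_sample Skip = False"
| "uses_sample (Const p v) = False"
| "uses_sample (Arith g p r s) = False"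
| "uses_sample (Flip p) = False"
| "uses_sample (Query p a) = False"
| "uses_sample (Sample p a) = True"
| "uses_sample (ReadMsg p r) = False"
| "uses_sample (Seq c1 c2) = (uses_sample c1 \<or> uses_sample c2)"
| "uses_sample (IfLe r s c1 c2) = (uses_sample c1 \<or> uses_sample c2)"
| "uses_sample (WhileLe r s c) = uses_sample c"

primrec uses_msg :: "prog \<Rightarrow> bool" where
  "uses_msg Skip = False"
| "uses_msg (Const p v) = False"
| "uses_msg (Arith g p r s) = False"
| "uses_msg (Flip p) = False"
| "uses_msg (Query p a) = False"
| "uses_msg (Sample p a) = False"
| "uses_msg (ReadMsg p r) = True"
| "uses_msg (Seq c1 c2) = (uses_msg c1 \<or> uses_msg c2)"
| "uses_msg (IfLe r s c1 c2) = (uses_msg c1 \<or> uses_msg c2)"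
| "uses_msg (WhileLe r s c) = uses_msg c"

section \<open>Distance estimators and learning algorithms\<close>

definition distance_estimator ::
  "nat \<Rightarrow> (bool list \<Rightarrow> bool) set \<Rightarrow> real \<Rightarrow> real \<Rightarrow> prog \<Rightarrow> bool" where
  "distance_estimator n H \<epsilon> \<delta> D \<longleftrightarrow>
     \<not> uses_sample D \<and> \<not> uses_msg D \<and>
     (\<forall>f\<in>bool_funs n.
        halts n f [] \<epsilon> \<delta> D \<and>
        (\<forall>A\<in>set_pmf (output_of n f [] \<epsilon> \<delta> D). A 0 \<in> {0..1}) \<and>
        measure_pmf.prob (output_of n f [] \<epsilon> \<delta> D) {A. \<bar>class_dist n f H - A 0\<bar> > \<epsilon>} < \<delta>)"

text \<open>Hypotheses are communicated as bit strings of the information-theoretically optimal length.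
  Decoding is onto \<open>H\<close>, hence total: every string of that length denotes a hypothesis.\<close>

definition code_length :: "'a set \<Rightarrow> nat" where
  "code_length H = nat \<lceil>log 2 (real (card H))\<rceil>"

definition represents :: "(bool list \<Rightarrow> (bool list \<Rightarrow> bool)) \<Rightarrow> (bool list \<Rightarrow> bool) set \<Rightarrow> bool" where
  "represents dec H \<longleftrightarrow> dec ` cube (code_length H) = H"

lemma finite_cube: "finite (cube n)"
  unfolding cube_def using finite_lists_length_eq[of "UNIV :: bool set" n] by simp

lemma card_cube: "card (cube n) = 2 ^ n"
  unfolding cube_def using card_lists_length_eq[of "UNIV :: bool set" n] by simp

lemma represents_exists:
  assumes "H \<subseteq> bool_funs n" "H \<noteq> {}"
  shows "\<exists>dec. represents dec H"
proof -
  have "finite H"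
    using assms(1) finite_PiE[OF finite_cube, of n "\<lambda>_. UNIV :: bool set"]
    unfolding bool_funs_def by (auto intro: finite_subset)
  hence pos: "card H > 0" using assms(2) by (simp add: card_gt_0_iff)
  have "log 2 (real (card H)) \<le> real (code_length H)"
    unfolding code_length_def by linarith
  hence "real (card H) \<le> 2 powr real (code_length H)"
    using pos by (simp add: log_le_iff)
  hence "real (card H) \<le> real (2 ^ code_length H)"
    by (simp add: powr_realpow)
  hence "card H \<le> card (cube (code_length H))"
    unfolding card_cube of_nat_le_iff .
  then obtain e where e: "inj_on e H" "e ` H \<subseteq> cube (code_length H)"
    using card_le_inj[OF \<open>finite H\<close> finite_cube] by blast
  obtain h0 where h0: "h0 \<in> H" using assms(2) by blast
  define dec where "dec m = (if m \<in> e ` H then inv_into H e m else h0)" for m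
  have "dec ` cube (code_length H) = H"
  proof
    show "dec ` cube (code_length H) \<subseteq> H"
      using h0 by (auto simp: dec_def inv_into_into)
    show "H \<subseteq> dec ` cube (code_length H)"
    proof
      fix h assume "h \<in> H"
      hence "dec (e h) = h" "e h \<in> cube (code_length H)"
        using e by (auto simp: dec_def)
      thus "h \<in> dec ` cube (code_length H)" by (metis imageI)
    qed
  qed
  thus ?thesis unfolding represents_def by blast
qed

text \<open>Estimates the distance between \<open>f\<close> and the hypothesis described on the message tape, from
  random examples only.\<close>
definition hypothesis_distance_estimator ::
  "nat \<Rightarrow> (bool list \<Rightarrow> bool) set \<Rightarrow> (bool list \<Rightarrow> (bool list \<Rightarrow> bool)) \<Rightarrow> real \<Rightarrow> real \<Rightarrow> prog \<Rightarrow> bool"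
  where
  "hypothesis_distance_estimator n H dec \<epsilon> \<delta> E \<longleftrightarrow>
     \<not> uses_query E \<and>
     (\<forall>f\<in>bool_funs n. \<forall>m\<in>cube (code_length H).
        halts n f m \<epsilon> \<delta> E \<and>
        measure_pmf.prob (output_of n f m \<epsilon> \<delta> E) {A. \<bar>fdist n f (dec m) - A 0\<bar> \<le> \<epsilon>} \<ge> 1 - \<delta>)"

definition learner_output ::
  "nat \<Rightarrow> (bool list \<Rightarrow> bool) set \<Rightarrow> real \<Rightarrow> real \<Rightarrow> prog \<Rightarrow> (bool list \<Rightarrow> bool) \<Rightarrow> bool list pmf" where
  "learner_output n H \<epsilon> \<delta> L f = map_pmf (read_bits (code_length H)) (output_of n f [] \<epsilon> \<delta> L)"

text \<open>Proper agnostic learning with respect to the uniform distribution.\<close>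
definition learning_algorithm ::
  "nat \<Rightarrow> (bool list \<Rightarrow> bool) set \<Rightarrow> (bool list \<Rightarrow> (bool list \<Rightarrow> bool)) \<Rightarrow> real \<Rightarrow> real \<Rightarrow> prog \<Rightarrow> bool"
  where
  "learning_algorithm n H dec \<epsilon> \<delta> L \<longleftrightarrow>
     (\<forall>f\<in>bool_funs n.
        halts n f [] \<epsilon> \<delta> L \<and>
        measure_pmf.prob (learner_output n H \<epsilon> \<delta> L f)
          {m. fdist n f (dec m) \<le> class_dist n f H + \<epsilon>} \<ge> 1 - \<delta>)"

section \<open>Proof systems consisting of a single message\<close>

text \<open>A prover is an arbitrary randomized map from the function \<open>f\<close> to messages of \<open>l\<close> bits.\<close>
definition prover :: "nat \<Rightarrow> nat \<Rightarrow> ((bool list \<Rightarrow> bool) \<Rightarrow> bool list pmf) \<Rightarrow> bool" where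
  "prover n l P \<longleftrightarrow> (\<forall>f\<in>bool_funs n. set_pmf (P f) \<subseteq> cube l)"

text \<open>The verifier, run on the message, either rejects (first output cell 0; the result is \<open>None\<close>)
  or adopts the hypothesis on its read-only message tape as the output.\<close>
definition interaction ::
  "nat \<Rightarrow> (bool list \<Rightarrow> (bool list \<Rightarrow> bool)) \<Rightarrow> real \<Rightarrow> real \<Rightarrow> prog \<Rightarrow>
   ((bool list \<Rightarrow> bool) \<Rightarrow> bool list pmf) \<Rightarrow> (bool list \<Rightarrow> bool) \<Rightarrow> (bool list \<Rightarrow> bool) option pmf" where
  "interaction n dec \<epsilon> \<delta> V P f =
     bind_pmf (P f) (\<lambda>m.
       map_pmf (\<lambda>A. if A 0 \<noteq> 0 then Some (dec m) else None) (output_of n f m \<epsilon> \<delta> V))"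

end

theory Submission imports Defs begin

text \<open>The verifier computes an estimate \<open>d\<close> of \<open>dist(f, H)\<close> with \<open>D\<close> and an estimate \<open>e\<close> of \<open>dist(f, h)\<close> for the
  received hypothesis \<open>h\<close> with \<open>E\<close>, and accepts iff \<open>e \<le> d + 2\<epsilon>/3\<close>. Unless one of the estimates is off by
  more than \<open>\<epsilon>/6\<close>, every \<open>h\<close> with \<open>dist(f, h) \<le> dist(f, H) + \<epsilon>/3\<close> is accepted and every \<open>h\<close> with
  \<open>dist(f, h) > dist(f, H) + \<epsilon>\<close> is rejected. The two programs do not interfere because their arrays are
  renamed apart. An error-free learner is the decision tree that queries all of \<open>f\<close> and has an
  optimal message at each leaf.\<close>

section \<open>Execution from arbitrary configurations\<close>

text \<open>\<open>run\<close> appends steps at the end and starts only in the initial memory.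
  Splitting off the first step instead, from any configuration, is what inductions over sequential
  composition need.\<close>

primrec steps :: "nat \<Rightarrow> (bool list \<Rightarrow> bool) \<Rightarrow> bool list \<Rightarrow> nat \<Rightarrow> config \<Rightarrow> config pmf" where
  "steps n f m 0 s = return_pmf s"
| "steps n f m (Suc t) s =
     bind_pmf (case s of (c, M, k) \<Rightarrow> step n f m c M k) (steps n f m t)"

lemma steps_0: "steps n f m 0 = return_pmf"
  by (rule ext) simp

lemma steps_add: "steps n f m (t + u) s = bind_pmf (steps n f m t s) (steps n f m u)"
  by (induction t arbitrary: s) (auto simp: bind_return_pmf bind_assoc_pmf intro!: bind_pmf_cong)

lemma run_eq_steps: "run n f m \<epsilon> \<delta> c t = steps n f m t (c, init_mem n \<epsilon> \<delta>, 0)"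
proof (induction t)
  case (Suc t)
  have eq: "steps n f m (Suc t) s =
      bind_pmf (steps n f m t s) (\<lambda>(c', M, k). step n f m c' M k)" for s
    unfolding Suc_eq_plus1 steps_add by (intro bind_pmf_cong) (auto simp: bind_return_pmf' steps_0)
  show ?case unfolding run.simps eq Suc ..
qed simp

lemma steps_Skip [simp]: "steps n f m t (Skip, M, k) = return_pmf (Skip, M, k)"
  by (induction t) (simp_all add: bind_return_pmf)

definition halted_after ::
  "nat \<Rightarrow> (bool list \<Rightarrow> bool) \<Rightarrow> bool list \<Rightarrow> nat \<Rightarrow> config \<Rightarrow> bool" where
  "halted_after n f m t s \<longleftrightarrow> (\<forall>s' \<in> set_pmf (steps n f m t s). fst s' = Skip)"

lemma halts_within_iff:
  "halts_within n f m \<epsilon> \<delta> c t \<longleftrightarrow> halted_after n f m t (c, init_mem n \<epsilon> \<delta>, 0)"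
  unfolding halts_within_def halted_after_def run_eq_steps by auto

text \<open>A halted configuration steps only to itself, so the \<open>u - t\<close> further steps
  amount to binding with \<open>return_pmf\<close>.\<close>

lemma steps_halted:
  assumes "halted_after n f m t s" "t \<le> u"
  shows "steps n f m u s = steps n f m t s"
proof -
  have "steps n f m (t + (u - t)) s = bind_pmf (steps n f m t s) return_pmf"
    unfolding steps_add
  proof (rule bind_pmf_cong[OF refl])
    fix s' assume "s' \<in> set_pmf (steps n f m t s)"
    then have "fst s' = Skip" using assms(1) by (simp add: halted_after_def)
    then show "steps n f m (u - t) s' = return_pmf s'" by (cases s') simp
  qed
  then show ?thesis using assms(2) by (simp add: bind_return_pmf')
qed

text \<open>Removes the \<open>LEAST\<close> from \<open>output_of\<close>: any known halting time
  serves, since nothing changes after the least one.\<close>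

lemma output_of_eq:
  assumes "halts_within n f m \<epsilon> \<delta> c t"
  shows "output_of n f m \<epsilon> \<delta> c =
    map_pmf (\<lambda>(_, M, _). M 1) (steps n f m t (c, init_mem n \<epsilon> \<delta>, 0))"
proof -
  let ?l = "LEAST t. halts_within n f m \<epsilon> \<delta> c t"
  have "halts_within n f m \<epsilon> \<delta> c ?l" "?l \<le> t"
    using assms by (auto intro: LeastI Least_le)
  then show ?thesis
    unfolding output_of_def run_eq_steps halts_within_iff
    using steps_halted[of n f m ?l "(c, init_mem n \<epsilon> \<delta>, 0)" t] by (simp add: halts_within_iff)
qed

text \<open>On some random branches \<open>c1\<close> may halt before time \<open>t\<close>, and
  then \<open>c2\<close> starts early. Since \<open>c2\<close> halts within \<open>u\<close> steps
  from every memory that \<open>c1\<close> leaves, the time gained is spent idling. The extra step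
  discards the finished \<open>Skip\<close>.\<close>

lemma steps_Seq:
  assumes "halted_after n f m t (c1, M, k)"
    and "\<And>c' M' k'. (c', M', k') \<in> set_pmf (steps n f m t (c1, M, k)) \<Longrightarrow>
      halted_after n f m u (c2, M', k')"
  shows "steps n f m (Suc (t + u)) (Seq c1 c2, M, k) =
    bind_pmf (steps n f m t (c1, M, k)) (\<lambda>(_, M', k'). steps n f m u (c2, M', k'))"
  using assms
proof (induction t arbitrary: c1 M k)
  case 0
  then have "c1 = Skip" by (simp add: halted_after_def)
  then show ?case by (simp add: bind_return_pmf)
next
  case (Suc t)
  show ?case
  proof (cases "c1 = Skip")
    case True
    \<comment> \<open>Here \<open>c1\<close> is already finished, so \<open>c2\<close> has
      \<open>Suc t\<close> idle steps on top of its own \<open>u\<close>.\<close>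
    then have "halted_after n f m u (c2, M, k)" using Suc.prems(2)[of Skip M k] by simp
    then have "steps n f m (Suc t + u) (c2, M, k) = steps n f m u (c2, M, k)"
      by (rule steps_halted) simp
    with True show ?thesis by (simp add: bind_return_pmf)
  next
    case False
    have "steps n f m (Suc (Suc t + u)) (Seq c1 c2, M, k) =
      bind_pmf (step n f m c1 M k) (\<lambda>(c', M', k'). steps n f m (Suc (t + u)) (Seq c' c2, M', k'))"
      using False by (simp add: bind_map_pmf split_def)
    also have "\<dots> = bind_pmf (step n f m c1 M k) (\<lambda>s. bind_pmf (steps n f m t s)
        (\<lambda>(_, M', k'). steps n f m u (c2, M', k')))"
    proof (rule bind_pmf_cong[OF refl])
      fix s assume s: "s \<in> set_pmf (step n f m c1 M k)"
      obtain c' M' k' where s': "s = (c', M', k')" by (cases s)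
      have sub: "set_pmf (steps n f m t s) \<subseteq> set_pmf (steps n f m (Suc t) (c1, M, k))"
        using s by auto
      have "halted_after n f m t (c', M', k')"
        using Suc.prems(1) sub unfolding s' halted_after_def by blast
      then have "steps n f m (Suc (t + u)) (Seq c' c2, M', k') = bind_pmf (steps n f m t (c', M', k'))
        (\<lambda>(_, M', k'). steps n f m u (c2, M', k'))"
        by (rule Suc.IH) (use Suc.prems(2) sub s' in blast)
      then show "(case s of (c', M', k') \<Rightarrow> steps n f m (Suc (t + u)) (Seq c' c2, M', k')) =
        bind_pmf (steps n f m t s) (\<lambda>(_, M', k'). steps n f m u (c2, M', k'))"
        by (simp add: s')
    qed
    also have "\<dots> = bind_pmf (steps n f m (Suc t) (c1, M, k))
        (\<lambda>(_, M', k'). steps n f m u (c2, M', k'))"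
      by (simp add: bind_assoc_pmf)
    finally show ?thesis .
  qed
qed

lemma halted_after_Seq:
  assumes "halted_after n f m t (c1, M, k)"
    and "\<And>c' M' k'. (c', M', k') \<in> set_pmf (steps n f m t (c1, M, k)) \<Longrightarrow>
      halted_after n f m u (c2, M', k')"
  shows "halted_after n f m (Suc (t + u)) (Seq c1 c2, M, k)"
proof -
  have eq: "steps n f m (Suc (t + u)) (Seq c1 c2, M, k) =
      bind_pmf (steps n f m t (c1, M, k)) (\<lambda>(_, M', k'). steps n f m u (c2, M', k'))"
    using assms by (rule steps_Seq)
  show ?thesis
    unfolding halted_after_def
  proof
    fix s assume "s \<in> set_pmf (steps n f m (Suc (t + u)) (Seq c1 c2, M, k))"
    then obtain s1 where s1: "s1 \<in> set_pmf (steps n f m t (c1, M, k))"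
      "s \<in> set_pmf (case s1 of (_, M', k') \<Rightarrow> steps n f m u (c2, M', k'))"
      unfolding eq set_bind_pmf by blast
    then show "fst s = Skip"
      using assms(2) by (cases s1) (auto simp: halted_after_def)
  qed
qed

section \<open>Query counts along executions\<close>

lemma step_queries_mono:
  "(c', M', k') \<in> set_pmf (step n f m c M k) \<Longrightarrow> k \<le> k'"
  by (induction c arbitrary: c' M' k') (auto simp: Let_def split: if_splits)

lemma steps_queries_mono:
  "(c', M', k') \<in> set_pmf (steps n f m t (c, M, k)) \<Longrightarrow> k \<le> k'"
proof (induction t arbitrary: c M k)
  case (Suc t)
  then obtain c1 M1 k1 where "(c1, M1, k1) \<in> set_pmf (step n f m c M k)"
    "(c', M', k') \<in> set_pmf (steps n f m t (c1, M1, k1))" by auto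
  then show ?case using Suc.IH step_queries_mono le_trans by blast
qed simp

text \<open>The number of queries never decreases, so it suffices to bound it in halted configurations.\<close>
lemma steps_queries_le:
  assumes "halted_after n f m T s"
    and "\<And>c M k. (c, M, k) \<in> set_pmf (steps n f m T s) \<Longrightarrow> k \<le> q"
    and "(c, M, k) \<in> set_pmf (steps n f m t s)"
  shows "k \<le> q"
proof -
  obtain s' where s': "s' \<in> set_pmf (steps n f m T (c, M, k))"
    using set_pmf_not_empty ex_in_conv by metis
  obtain c' M' k' where [simp]: "s' = (c', M', k')" by (cases s')
  \<comment> \<open>A configuration reached at time \<open>t\<close> is continued for
    \<open>T\<close> more steps; by then the distribution is the halted one of time
    \<open>T\<close>, whose counts are bounded by \<open>q\<close>.\<close>
  have "s' \<in> set_pmf (steps n f m (t + T) s)"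
    unfolding steps_add using assms(3) s' by auto
  then have "s' \<in> set_pmf (steps n f m T s)"
    using steps_halted[OF assms(1), of "t + T"] by simp
  then have "k' \<le> q" using assms(2) by simp
  moreover have "k \<le> k'" using s' steps_queries_mono by simp
  ultimately show ?thesis by simp
qed

text \<open>The second conjunct is the invariant that allows the bound to be iterated over many
  steps.\<close>

lemma step_no_query:
  "\<not> uses_query c \<Longrightarrow> (c', M', k') \<in> set_pmf (step n f m c M k) \<Longrightarrow> k' \<le> k \<and> \<not> uses_query c'"
proof (induction c arbitrary: c' M' k')
  case (Seq c1 c2)
  show ?case
  proof (cases "c1 = Skip")
    case False
    then obtain d where "c' = Seq d c2" "(d, M', k') \<in> set_pmf (step n f m c1 M k)"
      using Seq.prems(2) by auto
    then show ?thesis using Seq.IH(1)[of d M' k'] Seq.prems(1) by simp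
  qed (use Seq.prems in simp)
next
  case (IfLe r s c1 c2)
  from IfLe.prems show ?case by (simp split: if_splits)
next
  case (WhileLe r s c)
  from WhileLe.prems show ?case by (simp split: if_splits)
qed (simp_all add: Let_def, auto)

lemma steps_no_query:
  "\<not> uses_query c \<Longrightarrow> (c', M', k') \<in> set_pmf (steps n f m t (c, M, k)) \<Longrightarrow> k' \<le> k"
proof (induction t arbitrary: c M k)
  case (Suc t)
  from Suc.prems(2) obtain c1 M1 k1 where s1: "(c1, M1, k1) \<in> set_pmf (step n f m c M k)"
    "(c', M', k') \<in> set_pmf (steps n f m t (c1, M1, k1))" by auto
  have "k1 \<le> k" "\<not> uses_query c1" using step_no_query[OF Suc.prems(1) s1(1)] by auto
  then show ?case using Suc.IH s1(2) le_trans by blast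
qed simp

section \<open>Independence of the message tape\<close>

lemma step_no_msg:
  assumes "\<not> uses_msg c"
  shows "step n f m c M k = step n f m' c M k"
    and "(c', M', k') \<in> set_pmf (step n f m c M k) \<Longrightarrow> \<not> uses_msg c'"
  using assms by (induction c arbitrary: c' M' k') (auto split: if_splits)

lemma steps_no_msg:
  "\<not> uses_msg c \<Longrightarrow> steps n f m t (c, M, k) = steps n f m' t (c, M, k)"
proof (induction t arbitrary: c M k)
  case (Suc t)
  show ?case
    unfolding steps.simps prod.case step_no_msg(1)[OF Suc.prems, of n f m M k m']
  proof (rule bind_pmf_cong[OF refl])
    fix s assume "s \<in> set_pmf (step n f m' c M k)"
    then show "steps n f m t s = steps n f m' t s"
      using Suc step_no_msg(2) by (cases s) blast
  qed
qed simp

section \<open>Renaming of arrays\<close>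

fun rename_addr :: "(nat \<Rightarrow> nat) \<Rightarrow> addr \<Rightarrow> addr" where
  "rename_addr r (Dir a i) = Dir (r a) i"
| "rename_addr r (Ind a b j) = Ind (r a) (r b) j"

primrec rename :: "(nat \<Rightarrow> nat) \<Rightarrow> prog \<Rightarrow> prog" where
  "rename r Skip = Skip"
| "rename r (Const p v) = Const (rename_addr r p) v"
| "rename r (Arith g p x y) = Arith g (rename_addr r p) (rename_addr r x) (rename_addr r y)"
| "rename r (Flip p) = Flip (rename_addr r p)"
| "rename r (Query p a) = Query (rename_addr r p) (r a)"
| "rename r (Sample p a) = Sample (rename_addr r p) (r a)"
| "rename r (ReadMsg p x) = ReadMsg (rename_addr r p) (rename_addr r x)"
| "rename r (Seq c1 c2) = Seq (rename r c1) (rename r c2)"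
| "rename r (IfLe x y c1 c2) = IfLe (rename_addr r x) (rename_addr r y) (rename r c1) (rename r c2)"
| "rename r (WhileLe x y c) = WhileLe (rename_addr r x) (rename_addr r y) (rename r c)"

lemma rename_eq_Skip [simp]: "rename r c = Skip \<longleftrightarrow> c = Skip"
  by (cases c) simp_all

text \<open>The shared memory while a renamed program works on its private memory \<open>M\<close>;
  \<open>M0\<close> is the surrounding memory that it cannot reach.\<close>

definition embed_mem :: "(nat \<Rightarrow> nat) \<Rightarrow> mem \<Rightarrow> mem \<Rightarrow> mem" where
  "embed_mem r M0 M = (\<lambda>a. if a \<in> range r then M (inv r a) else M0 a)"

lemma embed_range [simp]: "inj r \<Longrightarrow> embed_mem r M0 M (r a) = M a"
  by (simp add: embed_mem_def)

lemma embed_notin [simp]: "a \<notin> range r \<Longrightarrow> embed_mem r M0 M a = M0 a"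
  by (simp add: embed_mem_def)

lemma embed_upd: "inj r \<Longrightarrow> (embed_mem r M0 M)(r a := A) = embed_mem r M0 (M(a := A))"
  by (auto simp: embed_mem_def fun_eq_iff inv_f_f)

lemma get_rename [simp]: "inj r \<Longrightarrow> get (embed_mem r M0 M) (rename_addr r p) = get M p"
  by (cases p) (simp_all add: get_def)

lemma put_rename [simp]:
  "inj r \<Longrightarrow> put (rename_addr r p) v (embed_mem r M0 M) = embed_mem r M0 (put p v M)"
  by (cases p) (simp_all add: put_def embed_upd)

text \<open>Indirect addressing computes an index inside an array but never the name of an array, so
  renaming commutes with every instruction. The offset \<open>k0\<close> stands for queries made
  earlier by other programs.\<close>

lemma step_rename:
  assumes "inj r"
  shows "step n f m (rename r c) (embed_mem r M0 M) (k + k0) =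
    map_pmf (\<lambda>(c', M', k'). (rename r c', embed_mem r M0 M', k' + k0)) (step n f m c M k)"
  using assms
  by (induction c)
    (auto simp: pmf.map_comp comp_def split_def embed_upd Let_def intro!: map_pmf_cong)

lemma steps_rename:
  assumes "inj r"
  shows "steps n f m t (rename r c, embed_mem r M0 M, k + k0) =
    map_pmf (\<lambda>(c', M', k'). (rename r c', embed_mem r M0 M', k' + k0)) (steps n f m t (c, M, k))"
proof (induction t arbitrary: c M k)
  case (Suc t)
  show ?case
    by (auto simp: step_rename[OF assms] bind_map_pmf map_bind_pmf Suc intro!: bind_pmf_cong)
qed simp

section \<open>An exact learner\<close>

primrec write_prog :: "nat \<Rightarrow> nat \<Rightarrow> bool list \<Rightarrow> prog" where
  "write_prog a i [] = Skip"
| "write_prog a i (b # bs) = Seq (Const (Dir a i) (of_bool b)) (write_prog a (Suc i) bs)"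

text \<open>The resources of the learner are left unbounded, so time and final query count are
  existentially quantified; the arbitrary initial count \<open>k\<close> makes the relation
  compose.\<close>

definition reaches ::
  "nat \<Rightarrow> (bool list \<Rightarrow> bool) \<Rightarrow> bool list \<Rightarrow> prog \<Rightarrow> mem \<Rightarrow> mem \<Rightarrow> bool" where
  "reaches n f m c M M' \<longleftrightarrow>
     (\<forall>k. \<exists>t k'. steps n f m t (c, M, k) = return_pmf (Skip, M', k'))"

lemma reachesI:
  assumes "\<And>k. step n f m c M k = return_pmf (Skip, M', g k)"
  shows "reaches n f m c M M'"
  unfolding reaches_def
proof
  fix k
  have "steps n f m (Suc 0) (c, M, k) = return_pmf (Skip, M', g k)"
    using assms by (simp add: bind_return_pmf)
  then show "\<exists>t k'. steps n f m t (c, M, k) = return_pmf (Skip, M', k')" by blast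
qed

lemma reaches_Seq:
  assumes "reaches n f m c1 M M'" "reaches n f m c2 M' M''"
  shows "reaches n f m (Seq c1 c2) M M''"
  unfolding reaches_def
proof
  fix k
  obtain t k' where 1: "steps n f m t (c1, M, k) = return_pmf (Skip, M', k')"
    using assms(1) by (meson reaches_def)
  obtain u k'' where 2: "steps n f m u (c2, M', k') = return_pmf (Skip, M'', k'')"
    using assms(2) by (meson reaches_def)
  have "steps n f m (Suc (t + u)) (Seq c1 c2, M, k) =
      bind_pmf (steps n f m t (c1, M, k)) (\<lambda>(_, M', k'). steps n f m u (c2, M', k'))"
    by (rule steps_Seq) (auto simp: halted_after_def 1 2)
  also have "\<dots> = return_pmf (Skip, M'', k'')" by (simp add: 1 2 bind_return_pmf)
  finally show "\<exists>t k'. steps n f m t (Seq c1 c2, M, k) = return_pmf (Skip, M'', k')" by blast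
qed

lemma reaches_IfLe:
  assumes "reaches n f m (if get M r \<le> get M s then c1 else c2) M M'"
  shows "reaches n f m (IfLe r s c1 c2) M M'"
  unfolding reaches_def
proof
  fix k
  obtain t k' where "steps n f m t (if get M r \<le> get M s then c1 else c2, M, k) =
      return_pmf (Skip, M', k')"
    using assms by (meson reaches_def)
  then have "steps n f m (Suc t) (IfLe r s c1 c2, M, k) = return_pmf (Skip, M', k')"
    by (simp add: bind_return_pmf)
  then show "\<exists>t k'. steps n f m t (IfLe r s c1 c2, M, k) = return_pmf (Skip, M', k')" by blast
qed

text \<open>Preservation of the cells below \<open>i\<close> carries the induction: the recursive
  call starts at \<open>Suc i\<close> and must keep the bit just written.\<close>

lemma reaches_write_prog:
  "\<exists>M'. reaches n f m (write_prog a i bs) M M' \<and> (\<forall>j < length bs. M' a (i + j) = of_bool (bs ! j)) \<and>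
     (\<forall>j < i. M' a j = M a j) \<and> (\<forall>b. b \<noteq> a \<longrightarrow> M' b = M b)"
proof (induction bs arbitrary: i M)
  case Nil
  have "reaches n f m Skip M M" by (rule reachesI[where g = id]) simp
  then show ?case by auto
next
  case (Cons b bs)
  let ?M = "put (Dir a i) (of_bool b) M"
  obtain M' where M': "reaches n f m (write_prog a (Suc i) bs) ?M M'"
    "\<forall>j < length bs. M' a (Suc i + j) = of_bool (bs ! j)"
    "\<forall>j < Suc i. M' a j = ?M a j" "\<forall>b. b \<noteq> a \<longrightarrow> M' b = ?M b"
    using Cons.IH[of "Suc i" ?M] by blast
  have "reaches n f m (Const (Dir a i) (of_bool b)) M ?M"
    by (rule reachesI[where g = id]) simp
  then have "reaches n f m (write_prog a i (b # bs)) M M'"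
    using M'(1) by (auto intro: reaches_Seq)
  moreover have "M' a (i + j) = of_bool ((b # bs) ! j)" if "j < length (b # bs)" for j
    using that M'(2,3) by (cases j) (simp_all add: put_def)
  moreover have "\<forall>j < i. M' a j = M a j" "\<forall>b. b \<noteq> a \<longrightarrow> M' b = M b"
    using M'(3,4) by (simp_all add: put_def)
  ultimately show ?case by blast
qed

text \<open>Cell \<open>(4, 0)\<close> is never written, so it contains 0 and the comparison branches on the last answer.\<close>
primrec decision_tree ::
  "((bool list \<Rightarrow> bool) \<Rightarrow> bool list) \<Rightarrow> bool list list \<Rightarrow> (bool list \<Rightarrow> bool) \<Rightarrow> prog" where
  "decision_tree g [] \<phi> = write_prog 1 0 (g \<phi>)"
| "decision_tree g (x # xs) \<phi> =
     Seq (write_prog 2 0 x) (Seq (Query (Dir 3 0) 2)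
       (IfLe (Dir 3 0) (Dir 4 0)
         (decision_tree g xs (\<phi>(x := False))) (decision_tree g xs (\<phi>(x := True)))))"

text \<open>Along the branch selected by the answers, the table \<open>\<phi>\<close> is overwritten
  with the values of \<open>f\<close> at the queried points, and the leaf writes \<open>g\<close> of
  the resulting table.\<close>

lemma reaches_decision_tree:
  assumes "set xs \<subseteq> cube n" "M 4 0 = 0"
  shows "\<exists>M'. reaches n f m (decision_tree g xs \<phi>) M M' \<and>
     (let bs = g (override_on \<phi> f (set xs)) in \<forall>j < length bs. M' 1 j = of_bool (bs ! j))"
  using assms
proof (induction xs arbitrary: M \<phi>)
  case Nil
  obtain M' where "reaches n f m (write_prog 1 0 (g \<phi>)) M M'"
    "\<forall>j < length (g \<phi>). M' 1 (0 + j) = of_bool (g \<phi> ! j)"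
    using reaches_write_prog[of n f m 1 0 "g \<phi>" M] by blast
  then show ?case by (auto simp: Let_def)
next
  case (Cons x xs)
  obtain M1 where M1: "reaches n f m (write_prog 2 0 x) M M1"
    "\<forall>j < length x. M1 2 (0 + j) = of_bool (x ! j)" "\<forall>b. b \<noteq> 2 \<longrightarrow> M1 b = M b"
    using reaches_write_prog[of n f m 2 0 x M] by blast
  have "length x = n" using Cons.prems(1) by (simp add: cube_def)
  then have "read_bits n (M1 2) = x"
    using M1(2) by (auto simp: read_bits_def intro: nth_equalityI)
  define M2 where "M2 = put (Dir 3 0) (of_bool (f x)) M1"
  have query: "reaches n f m (Query (Dir 3 0) 2) M1 M2"
    by (rule reachesI[where g = Suc]) (simp add: M2_def \<open>read_bits n (M1 2) = x\<close>)
  have M2: "M2 4 0 = 0" "M2 3 0 = of_bool (f x)"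
    using M1(3) Cons.prems(2) by (simp_all add: M2_def put_def)
  obtain M' where M': "reaches n f m (decision_tree g xs (\<phi>(x := f x))) M2 M'"
    "let bs = g (override_on (\<phi>(x := f x)) f (set xs)) in \<forall>j < length bs. M' 1 j = of_bool (bs ! j)"
    using Cons.IH[of M2 "\<phi>(x := f x)", OF _ M2(1)] Cons.prems(1) by (meson set_subset_Cons subset_trans)
  have "reaches n f m (decision_tree g (x # xs) \<phi>) M M'"
    unfolding decision_tree.simps
    using M1(1) query
    by (rule reaches_Seq[OF _ reaches_Seq[OF _ reaches_IfLe]])
      (use M'(1) M2 in \<open>cases "f x"; simp add: get_def\<close>)
  moreover have "override_on (\<phi>(x := f x)) f (set xs) = override_on \<phi> f (set (x # xs))"
    by (auto simp: override_on_def)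
  ultimately show ?case using M'(2) by (intro exI[of _ M'] conjI) simp_all
qed

lemma finite_bool_funs: "finite (bool_funs n)"
  unfolding bool_funs_def by (intro finite_PiE finite_cube) simp

lemma read_bits_eqI:
  assumes "length bs = k" "\<And>j. j < k \<Longrightarrow> A j = of_bool (bs ! j)"
  shows "read_bits k A = bs"
  using assms by (auto simp: read_bits_def intro: nth_equalityI)

text \<open>Provides the honest prover: after querying the whole cube the tree knows
  \<open>f\<close>, and a nearest hypothesis exists because \<open>H\<close> is finite and has a
  code because \<open>dec\<close> is onto \<open>H\<close>.\<close>

theorem exact_learner_exists:
  assumes "H \<subseteq> bool_funs n" "H \<noteq> {}" "represents dec H" "0 \<le> \<epsilon>"
  shows "\<exists>L. learning_algorithm n H dec \<epsilon> 0 L"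
proof -
  \<comment> \<open>\<open>g\<close> need not be computed by a program: its values are hardwired at
    the leaves of the tree.\<close>
  define g where "g \<phi> = (SOME m. m \<in> cube (code_length H) \<and> fdist n \<phi> (dec m) = class_dist n \<phi> H)" for \<phi>
  have g: "length (g \<phi>) = code_length H" "fdist n \<phi> (dec (g \<phi>)) = class_dist n \<phi> H" for \<phi>
  proof -
    have "class_dist n \<phi> H \<in> fdist n \<phi> ` H"
      unfolding class_dist_def using assms finite_subset[OF _ finite_bool_funs] by (intro Min_in) auto
    then have "\<exists>m. m \<in> cube (code_length H) \<and> fdist n \<phi> (dec m) = class_dist n \<phi> H"
      using assms(3) unfolding represents_def by (metis imageE)
    then have "g \<phi> \<in> cube (code_length H) \<and> fdist n \<phi> (dec (g \<phi>)) = class_dist n \<phi> H"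
      unfolding g_def by (rule someI_ex)
    then show "length (g \<phi>) = code_length H" "fdist n \<phi> (dec (g \<phi>)) = class_dist n \<phi> H"
      by (auto simp: cube_def)
  qed
  obtain xs where xs: "set xs = cube n" using finite_list[OF finite_cube] by blast
  \<comment> \<open>Members of \<open>bool_funs n\<close> are \<open>undefined\<close> off the cube,
    so this initial table becomes \<open>f\<close> itself once all points of the cube are
    queried.\<close>
  define L where "L = decision_tree g xs (\<lambda>_. undefined)"
  have "halts n f [] \<epsilon> 0 L \<and> learner_output n H \<epsilon> 0 L f = return_pmf (g f)"
    if f: "f \<in> bool_funs n" for f
  proof -
    have "override_on (\<lambda>_. undefined) f (set xs) = f"
      using f unfolding xs bool_funs_def by (auto simp: override_on_def PiE_def extensional_def)
    then obtain M where M: "reaches n f [] L (init_mem n \<epsilon> 0) M"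
      "\<forall>j < length (g f). M 1 j = of_bool (g f ! j)"
      using reaches_decision_tree[of xs n "init_mem n \<epsilon> 0" f "[]" g "\<lambda>_. undefined"] xs
      by (auto simp: Let_def L_def init_mem_def)
    obtain t k where t: "steps n f [] t (L, init_mem n \<epsilon> 0, 0) = return_pmf (Skip, M, k)"
      using M(1) by (meson reaches_def)
    then have halt: "halts_within n f [] \<epsilon> 0 L t"
      by (simp add: halts_within_iff halted_after_def)
    have "read_bits (code_length H) (M 1) = g f"
      using M(2) by (intro read_bits_eqI) (simp_all add: g)
    then show ?thesis
      using halt by (auto simp: halts_def learner_output_def output_of_eq[OF halt] t)
  qed
  then have "learning_algorithm n H dec \<epsilon> 0 L"
    using g(2) assms(4) by (auto simp: learning_algorithm_def indicator_def)
  then show ?thesis by blast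
qed

section \<open>The verifier\<close>

lemma embed_mem_id: "(\<And>a. M0 (r a) = M a) \<Longrightarrow> inj r \<Longrightarrow> embed_mem r M0 M = M0"
  by (auto simp: embed_mem_def fun_eq_iff inv_f_f)

text \<open>Even numbers from 2 and odd numbers from 3 are disjoint and leave arrays 0 and 1 to the
  verifier itself.\<close>

definition ren_D :: "nat \<Rightarrow> nat" where "ren_D a = 2 * a + 2"
definition ren_E :: "nat \<Rightarrow> nat" where "ren_E a = 2 * a + 3"

lemma inj_ren: "inj ren_D" "inj ren_E"
  by (auto simp: ren_D_def ren_E_def inj_def)

lemma ren_disjoint:
  "ren_E a \<notin> range ren_D" "ren_D a \<notin> range ren_E" "1 \<notin> range ren_D" "1 \<notin> range ren_E"
  by (auto simp: ren_D_def ren_E_def) presburger+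

text \<open>Arrays 0 and 1 remain the input and output of the verifier; cells 1 to 4 of array 1 serve as
  scratch space, and cell \<open>(1, 3)\<close> keeps the constant \<open>2 * \<epsilon> / 3\<close> for the final comparison. The other
  arrays are shared between the renamed estimators, so array 2 (array 3) is the input of \<open>D\<close> (\<open>E\<close>).\<close>
definition setup_prog :: prog where
  "setup_prog =
     Seq (Const (Dir 1 1) 6) (
     Seq (Const (Dir 1 2) 2) (
     Seq (Arith Add (Dir 2 0) (Dir 0 0) (Dir 1 0)) (
     Seq (Arith Div (Dir 2 1) (Dir 0 1) (Dir 1 1)) (
     Seq (Arith Div (Dir 2 2) (Dir 0 2) (Dir 1 2)) (
     Seq (Arith Add (Dir 3 0) (Dir 0 0) (Dir 1 0)) (
     Seq (Arith Div (Dir 3 1) (Dir 0 1) (Dir 1 1)) (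
     Seq (Arith Div (Dir 3 2) (Dir 0 2) (Dir 1 2)) (
     Seq (Const (Dir 1 4) 4)
         (Arith Mult (Dir 1 3) (Dir 2 1) (Dir 1 4))))))))))"

definition setup_mem :: "nat \<Rightarrow> real \<Rightarrow> real \<Rightarrow> mem" where
  "setup_mem n \<epsilon> \<delta> = (init_mem n \<epsilon> \<delta>)
     (1 := (\<lambda>_. 0)(1 := 6, 2 := 2, 3 := 2 * \<epsilon> / 3, 4 := 4),
      2 := init_mem n (\<epsilon> / 6) (\<delta> / 2) 0, 3 := init_mem n (\<epsilon> / 6) (\<delta> / 2) 0)"

text \<open>Ten instructions, and nine steps that discard the finished first part of a
  \<open>Seq\<close>.\<close>

lemma steps_setup:
  "steps n f m 19 (setup_prog, init_mem n \<epsilon> \<delta>, k) =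
     return_pmf (Skip, setup_mem n \<epsilon> \<delta>, k)"
proof -
  \<comment> \<open>The symbolic execution is done for a generic \<open>M\<close>. A zero in cell
    \<open>(1, 0)\<close> turns the two additions into copies of the dimension; the product of
    \<open>\<epsilon> / 6\<close> and 4 is the slack \<open>2 * \<epsilon> / 3\<close>.\<close>
  have "steps n f m 19 (setup_prog, M, k) = return_pmf (Skip,
      (put (Dir 1 3) (get M (Dir 0 1) / 6 * 4) \<circ> put (Dir 1 4) 4 \<circ>
       put (Dir 3 2) (get M (Dir 0 2) / 2) \<circ> put (Dir 3 1) (get M (Dir 0 1) / 6) \<circ>
       put (Dir 3 0) (get M (Dir 0 0)) \<circ> put (Dir 2 2) (get M (Dir 0 2) / 2) \<circ>
       put (Dir 2 1) (get M (Dir 0 1) / 6) \<circ> put (Dir 2 0) (get M (Dir 0 0)) \<circ>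
       put (Dir 1 2) 2 \<circ> put (Dir 1 1) 6) M, k)" if "M 1 0 = 0" for M
    using that
    by (simp add: setup_prog_def eval_nat_numeral bind_return_pmf get_def put_def)
  then show ?thesis
    by (simp add: init_mem_def setup_mem_def get_def put_def fun_eq_iff)
qed

text \<open>Arrays 2 and 3 hold the rescaled inputs, and all higher arrays are still zero, so each
  estimator finds its own initial memory.\<close>

lemma setup_mem_ren:
  "setup_mem n \<epsilon> \<delta> (ren_D a) = init_mem n (\<epsilon> / 6) (\<delta> / 2) a"
  "setup_mem n \<epsilon> \<delta> (ren_E a) = init_mem n (\<epsilon> / 6) (\<delta> / 2) a"
  by (cases a; simp add: setup_mem_def ren_D_def ren_E_def init_mem_def)+

text \<open>Cell \<open>(1, 0)\<close> still holds its initial 0, which means rejection, so only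
  acceptance has to be written.\<close>

definition decide_prog :: prog where
  "decide_prog =
     Seq (Arith Add (Dir 1 4) (Dir (ren_D 1) 0) (Dir 1 3))
         (IfLe (Dir (ren_E 1) 0) (Dir 1 4) (Const (Dir 1 0) 1) Skip)"

definition decide_mem :: "mem \<Rightarrow> mem" where
  "decide_mem M =
     (let d = M (ren_D 1) 0 + M 1 3; M' = put (Dir 1 4) d M
      in if M (ren_E 1) 0 \<le> d then put (Dir 1 0) 1 M' else M')"

text \<open>Addition, discarding of \<open>Skip\<close>, branching, and the final write; when
  rejecting, the fourth step idles.\<close>

lemma steps_decide: "steps n f m 4 (decide_prog, M, k) = return_pmf (Skip, decide_mem M, k)"
  by (simp add: eval_nat_numeral bind_return_pmf decide_prog_def decide_mem_def Let_def
      get_def put_def ren_E_def)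

definition verifier :: "prog \<Rightarrow> prog \<Rightarrow> prog" where
  "verifier D E = Seq setup_prog (Seq (rename ren_D D) (Seq (rename ren_E E) decide_prog))"

definition final_mem :: "nat \<Rightarrow> real \<Rightarrow> real \<Rightarrow> mem \<Rightarrow> mem \<Rightarrow> mem" where
  "final_mem n \<epsilon> \<delta> MD ME =
     decide_mem (embed_mem ren_E (embed_mem ren_D (setup_mem n \<epsilon> \<delta>) MD) ME)"

text \<open>Since the ranges of the renamings are disjoint and avoid array 1, the run of
  \<open>E\<close> preserves both the output of \<open>D\<close> and the stored slack.\<close>

lemma final_mem_output:
  "final_mem n \<epsilon> \<delta> MD ME 1 0 \<noteq> 0 \<longleftrightarrow> ME 1 0 \<le> MD 1 0 + 2 * \<epsilon> / 3"
proof -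
  let ?M = "embed_mem ren_E (embed_mem ren_D (setup_mem n \<epsilon> \<delta>) MD) ME"
  have "?M (ren_D 1) = MD 1" "?M (ren_E 1) = ME 1" "?M 1 = setup_mem n \<epsilon> \<delta> 1"
    by (simp_all add: inj_ren ren_disjoint del: One_nat_def)
  then show ?thesis
    by (simp add: final_mem_def decide_mem_def Let_def put_def setup_mem_def)
qed

lemma steps_rename_from:
  assumes "inj r" "\<And>a. M0 (r a) = M a"
  shows "steps n f m t (rename r c, M0, k) =
    map_pmf (\<lambda>(c', M', k'). (rename r c', embed_mem r M0 M', k' + k)) (steps n f m t (c, M, 0))"
  using steps_rename[OF assms(1), of n f m t c M0 M 0 k] embed_mem_id[of M0 r M] assms by simp

lemma halted_after_rename:
  assumes "inj r" "\<And>a. M0 (r a) = M a" "halted_after n f m t (c, M, 0)"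
  shows "halted_after n f m t (rename r c, M0, k)"
proof -
  have "steps n f m t (rename r c, M0, k) =
    map_pmf (\<lambda>(c', M', k'). (rename r c', embed_mem r M0 M', k' + k)) (steps n f m t (c, M, 0))"
    using assms(1,2) by (rule steps_rename_from)
  then show ?thesis using assms(3) by (auto simp: halted_after_def)
qed

context
  fixes n :: nat and f :: "bool list \<Rightarrow> bool" and m :: "bool list" and \<epsilon> \<delta> :: real
    and D E :: prog and T_D T_E :: nat
  assumes halt_D: "halted_after n f m T_D (D, init_mem n (\<epsilon> / 6) (\<delta> / 2), 0)"
    and halt_E: "halted_after n f m T_E (E, init_mem n (\<epsilon> / 6) (\<delta> / 2), 0)"
begin

text \<open>The times 19 and 4 belong to setup and decision; each of the three sequential
  compositions costs one more step. Query counts simply add up.\<close>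

lemma verifier_run:
  defines "T \<equiv> Suc (19 + Suc (T_D + Suc (T_E + 4)))"
  shows "steps n f m T (verifier D E, init_mem n \<epsilon> \<delta>, 0) =
      bind_pmf (steps n f m T_D (D, init_mem n (\<epsilon> / 6) (\<delta> / 2), 0)) (\<lambda>(_, MD, kD).
      map_pmf (\<lambda>(_, ME, kE). (Skip, final_mem n \<epsilon> \<delta> MD ME, kE + kD))
        (steps n f m T_E (E, init_mem n (\<epsilon> / 6) (\<delta> / 2), 0)))" (is ?run)
    and "halted_after n f m T (verifier D E, init_mem n \<epsilon> \<delta>, 0)" (is ?halt)
proof -
  let ?I = "init_mem n (\<epsilon> / 6) (\<delta> / 2)" and ?S = "setup_mem n \<epsilon> \<delta>"
  let ?E = "Seq (rename ren_E E) decide_prog"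
  let ?D = "Seq (rename ren_D D) ?E"
  have halt_D': "halted_after n f m T_D (rename ren_D D, ?S, k)" for k
    by (rule halted_after_rename[OF inj_ren(1) _ halt_D]) (rule setup_mem_ren)
  have eq_D: "steps n f m T_D (rename ren_D D, ?S, k) =
    map_pmf (\<lambda>(c', M', k'). (rename ren_D c', embed_mem ren_D ?S M', k' + k))
      (steps n f m T_D (D, ?I, 0))" for k
    by (rule steps_rename_from[OF inj_ren(1)]) (rule setup_mem_ren)
  \<comment> \<open>Whatever \<open>D\<close> has done, \<open>E\<close> starts in its own initial
    memory; this makes the two estimates independent.\<close>
  have mem_E: "embed_mem ren_D ?S M (ren_E a) = ?I a" for M a
    using ren_disjoint(1) setup_mem_ren(2) by simp
  have halt_E': "halted_after n f m T_E (rename ren_E E, embed_mem ren_D ?S M, k)" for M k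
    by (rule halted_after_rename[OF inj_ren(2) _ halt_E]) (rule mem_E)
  have eq_E: "steps n f m T_E (rename ren_E E, embed_mem ren_D ?S M, k) =
    map_pmf (\<lambda>(c', M', k'). (rename ren_E c', embed_mem ren_E (embed_mem ren_D ?S M) M', k' + k))
      (steps n f m T_E (E, ?I, 0))" for M k
    by (rule steps_rename_from[OF inj_ren(2)]) (rule mem_E)
  have halt_decide: "halted_after n f m 4 (decide_prog, M, k)" for M k
    by (simp add: halted_after_def steps_decide)
  have halt_ED: "halted_after n f m (Suc (T_E + 4)) (?E, embed_mem ren_D ?S M, k)" for M k
    by (rule halted_after_Seq[OF halt_E' halt_decide])
  have run_ED: "steps n f m (Suc (T_E + 4)) (?E, embed_mem ren_D ?S M, k) =
    map_pmf (\<lambda>(_, ME, kE). (Skip, final_mem n \<epsilon> \<delta> M ME, kE + k)) (steps n f m T_E (E, ?I, 0))" for M k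
    unfolding steps_Seq[OF halt_E' halt_decide] eq_E bind_map_pmf map_pmf_def[of "\<lambda>(_, ME, kE). _ ME kE"]
    by (intro bind_pmf_cong refl) (auto simp: steps_decide final_mem_def)
  have halt_after_D: "halted_after n f m (Suc (T_E + 4)) (?E, M', k')"
    if "(c', M', k') \<in> set_pmf (steps n f m T_D (rename ren_D D, ?S, k))" for c' M' k' k
    using that halt_ED unfolding eq_D by auto
  have run_setup: "steps n f m 19 (setup_prog, init_mem n \<epsilon> \<delta>, 0) = return_pmf (Skip, ?S, 0)"
    by (rule steps_setup)
  have halt_setup: "halted_after n f m 19 (setup_prog, init_mem n \<epsilon> \<delta>, 0)"
    by (simp add: halted_after_def run_setup)
  have halt_DE: "halted_after n f m (Suc (T_D + Suc (T_E + 4))) (?D, M', k')"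
    if "(c', M', k') \<in> set_pmf (steps n f m 19 (setup_prog, init_mem n \<epsilon> \<delta>, 0))" for c' M' k'
  proof -
    have [simp]: "M' = ?S" using that by (simp add: run_setup)
    show ?thesis using halted_after_Seq[OF halt_D' halt_after_D] by simp
  qed
  show ?halt unfolding T_def verifier_def
    by (rule halted_after_Seq[OF halt_setup halt_DE])
  have "steps n f m T (verifier D E, init_mem n \<epsilon> \<delta>, 0) =
      bind_pmf (steps n f m 19 (setup_prog, init_mem n \<epsilon> \<delta>, 0))
        (\<lambda>(_, M', k'). steps n f m (Suc (T_D + Suc (T_E + 4))) (?D, M', k'))"
    unfolding T_def verifier_def by (rule steps_Seq[OF halt_setup halt_DE])
  also have "\<dots> = steps n f m (Suc (T_D + Suc (T_E + 4))) (?D, ?S, 0)"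
    unfolding run_setup bind_return_pmf prod.case ..
  also have "\<dots> = bind_pmf (steps n f m T_D (rename ren_D D, ?S, 0))
      (\<lambda>(_, M', k'). steps n f m (Suc (T_E + 4)) (?E, M', k'))"
    by (rule steps_Seq[OF halt_D' halt_after_D])
  also have "\<dots> = bind_pmf (steps n f m T_D (D, ?I, 0)) (\<lambda>(_, MD, kD).
      map_pmf (\<lambda>(_, ME, kE). (Skip, final_mem n \<epsilon> \<delta> MD ME, kE + kD))
        (steps n f m T_E (E, ?I, 0)))"
    unfolding eq_D bind_map_pmf
    by (intro bind_pmf_cong refl) (simp only: split_paired_all prod.case run_ED add_0_right)
  finally show ?run .
qed

text \<open>The distribution of the run of \<open>E\<close> does not depend on the outcome of
  \<open>D\<close>, so the nested bind is a product distribution.\<close>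

lemma verifier_output:
  "map_pmf (\<lambda>A. A 0 \<noteq> 0) (output_of n f m \<epsilon> \<delta> (verifier D E)) =
   map_pmf (\<lambda>(A, B). B 0 \<le> A 0 + 2 * \<epsilon> / 3)
     (pair_pmf (output_of n f m (\<epsilon> / 6) (\<delta> / 2) D) (output_of n f m (\<epsilon> / 6) (\<delta> / 2) E))"
  unfolding output_of_eq[OF verifier_run(2)[folded halts_within_iff]]
    output_of_eq[OF halt_D[folded halts_within_iff]]
    output_of_eq[OF halt_E[folded halts_within_iff]] verifier_run(1)
  by (auto simp: map_bind_pmf pmf.map_comp comp_def split_def final_mem_output pair_pmf_def
      bind_map_pmf map_pmf_def[symmetric] simp del: One_nat_def intro!: bind_pmf_cong map_pmf_cong)

end

section \<open>Error probabilities\<close>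

text \<open>Union bound for a two-stage experiment: \<open>Y\<close> collects the unwanted messages
  of the prover, and \<open>b\<close> bounds the error of the verifier on the others.\<close>

lemma prob_bind_pmf_le:
  assumes "0 \<le> b"
    and "\<And>x. x \<in> set_pmf p \<Longrightarrow> x \<notin> Y \<Longrightarrow> measure_pmf.prob (g x) X \<le> b"
  shows "measure_pmf.prob (bind_pmf p g) X \<le> measure_pmf.prob p Y + b"
proof -
  have "emeasure (measure_pmf (bind_pmf p g)) X = (\<integral>\<^sup>+x. emeasure (g x) X \<partial>p)"
    by (rule emeasure_bind_pmf)
  \<comment> \<open>On \<open>Y\<close> the probability is bounded by 1, the value of the indicator
    there.\<close>
  also have "\<dots> \<le> (\<integral>\<^sup>+x. indicator Y x + ennreal b \<partial>p)"
  proof (rule nn_integral_mono_AE, rule AE_pmfI)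
    fix x assume "x \<in> set_pmf p"
    then show "emeasure (g x) X \<le> indicator Y x + ennreal b"
      using assms(2)[of x] measure_pmf.emeasure_le_1[of "g x" X]
      by (cases "x \<in> Y")
        (auto simp: measure_pmf.emeasure_eq_measure ennreal_leI intro: add_increasing2)
  qed
  also have "\<dots> = emeasure p Y + ennreal b"
    by (simp add: nn_integral_add measure_pmf.emeasure_space_1)
  also have "\<dots> = ennreal (measure_pmf.prob p Y + b)"
    using assms(1) by (simp add: measure_pmf.emeasure_eq_measure)
  finally show ?thesis
    using assms(1) by (simp add: measure_pmf.emeasure_eq_measure flip: ennreal_plus)
qed

text \<open>Union bound; each of the two events concerns one coordinate only and so has the
  probability given by that marginal.\<close>

lemma prob_pair_pmf_le:
  "measure_pmf.prob (pair_pmf p q) {(a, b). a \<in> X \<or> b \<in> Y} \<le>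
     measure_pmf.prob p X + measure_pmf.prob q Y"
proof -
  have "measure_pmf.prob (pair_pmf p q) {(a, b). a \<in> X \<or> b \<in> Y} =
      measure_pmf.prob (pair_pmf p q) (fst -` X \<union> snd -` Y)"
    by (rule arg_cong[where f = "measure_pmf.prob _"]) auto
  also have "\<dots> \<le> measure_pmf.prob (pair_pmf p q) (fst -` X) + measure_pmf.prob (pair_pmf p q) (snd -` Y)"
    by (rule measure_subadditive) simp_all
  also have "\<dots> = measure_pmf.prob (map_pmf fst (pair_pmf p q)) X + measure_pmf.prob (map_pmf snd (pair_pmf p q)) Y"
    by (simp only: measure_map_pmf)
  finally show ?thesis by (simp only: map_fst_pair_pmf map_snd_pair_pmf)
qed

lemma prob_Compl_pmf: "measure_pmf.prob p (- X) = 1 - measure_pmf.prob p X"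
  using measure_pmf.prob_compl[of X p] by (simp add: Compl_eq_Diff_UNIV)

text \<open>The guarantee of \<open>D\<close> is stated for an empty tape, whereas inside the
  verifier \<open>D\<close> runs with the message of the prover on the tape.\<close>

lemma output_of_no_msg:
  assumes "\<not> uses_msg c"
  shows "output_of n f m \<epsilon> \<delta> c = output_of n f m' \<epsilon> \<delta> c"
  unfolding output_of_def halts_within_def run_eq_steps
  by (simp only: steps_no_msg[OF assms, of n f m _ _ _ m'])

section \<open>Guarantees of the verifier\<close>

locale estimators =
  fixes n :: nat and H :: "(bool list \<Rightarrow> bool) set" and dec :: "bool list \<Rightarrow> bool list \<Rightarrow> bool"
    and \<epsilon> \<delta> :: real and D E :: prog and q T_D T_E :: nat
  assumes pos: "\<epsilon> > 0" "\<delta> > 0"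
    and H: "H \<subseteq> bool_funs n" "H \<noteq> {}" "represents dec H"
    and D: "distance_estimator n H (\<epsilon> / 6) (\<delta> / 2) D"
      "queries_le n {[]} (\<epsilon> / 6) (\<delta> / 2) D q" "time_le n {[]} (\<epsilon> / 6) (\<delta> / 2) D T_D"
    and E: "hypothesis_distance_estimator n H dec (\<epsilon> / 6) (\<delta> / 2) E"
      "time_le n (cube (code_length H)) (\<epsilon> / 6) (\<delta> / 2) E T_E"
begin

abbreviation "V \<equiv> verifier D E"
abbreviation "messages \<equiv> cube (code_length H)"

lemma no_msg_D: "\<not> uses_msg D"
  using D(1) by (simp add: distance_estimator_def)

lemma halt_D: "f \<in> bool_funs n \<Longrightarrow> halted_after n f m T_D (D, init_mem n (\<epsilon> / 6) (\<delta> / 2), 0)"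
  using D(3) steps_no_msg[OF no_msg_D]
  unfolding time_le_def halts_within_iff halted_after_def by (metis singletonI)

lemma halt_E:
  "f \<in> bool_funs n \<Longrightarrow> m \<in> messages \<Longrightarrow> halted_after n f m T_E (E, init_mem n (\<epsilon> / 6) (\<delta> / 2), 0)"
  using E(2) by (simp add: time_le_def halts_within_iff)

lemma time_verifier: "time_le n messages \<epsilon> \<delta> V (T_D + T_E + 26)"
  using verifier_run(2)[OF halt_D halt_E]
  by (auto simp: time_le_def halts_within_iff eval_nat_numeral algebra_simps)

text \<open>Only \<open>D\<close> contributes queries: setup and decision make none, and
  \<open>E\<close> works from random examples.\<close>

lemma queries_verifier: "queries_le n messages \<epsilon> \<delta> V q"
  unfolding queries_le_def run_eq_steps
proof (intro ballI allI, clarify)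
  fix f m t c M k
  assume f: "f \<in> bool_funs n" and m: "m \<in> messages"
    and k: "(c, M, k) \<in> set_pmf (steps n f m t (V, init_mem n \<epsilon> \<delta>, 0))"
  note run = verifier_run[OF halt_D[OF f, of m] halt_E[OF f m]]
  show "k \<le> q"
  proof (rule steps_queries_le[OF run(2) _ k])
    fix c M k
    assume "(c, M, k) \<in> set_pmf (steps n f m (Suc (19 + Suc (T_D + Suc (T_E + 4)))) (V, init_mem n \<epsilon> \<delta>, 0))"
    then obtain c1 M1 k1 c2 M2 k2 where k: "k = k2 + k1"
      and 1: "(c1, M1, k1) \<in> set_pmf (steps n f m T_D (D, init_mem n (\<epsilon> / 6) (\<delta> / 2), 0))"
      and 2: "(c2, M2, k2) \<in> set_pmf (steps n f m T_E (E, init_mem n (\<epsilon> / 6) (\<delta> / 2), 0))"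
      unfolding run(1) by fastforce
    have "k1 \<le> q"
      using 1 D(2) f unfolding queries_le_def run_eq_steps steps_no_msg[OF no_msg_D, of n f m _ _ _ "[]"]
      by fastforce
    moreover have "k2 \<le> 0"
      using E(1) 2 by (intro steps_no_query) (auto simp: hypothesis_distance_estimator_def)
    ultimately show "k \<le> q" using k by simp
  qed
qed

definition accept :: "(bool list \<Rightarrow> bool) \<Rightarrow> bool list \<Rightarrow> bool pmf" where
  "accept f m = map_pmf (\<lambda>(A, B). B 0 \<le> A 0 + 2 * \<epsilon> / 3)
     (pair_pmf (output_of n f [] (\<epsilon> / 6) (\<delta> / 2) D) (output_of n f m (\<epsilon> / 6) (\<delta> / 2) E))"

lemma interaction_eq:
  assumes f: "f \<in> bool_funs n" and P: "set_pmf (P f) \<subseteq> messages"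
  shows "interaction n dec \<epsilon> \<delta> V P f =
    bind_pmf (P f) (\<lambda>m. map_pmf (\<lambda>b. if b then Some (dec m) else None) (accept f m))"
  unfolding interaction_def
proof (rule bind_pmf_cong[OF refl])
  fix m assume "m \<in> set_pmf (P f)"
  then have m: "m \<in> messages" using P by blast
  show "map_pmf (\<lambda>A. if A 0 \<noteq> 0 then Some (dec m) else None) (output_of n f m \<epsilon> \<delta> V) =
    map_pmf (\<lambda>b. if b then Some (dec m) else None) (accept f m)"
    unfolding accept_def output_of_no_msg[OF no_msg_D, of n f "[]" _ _ m]
      verifier_output[OF halt_D[OF f] halt_E[OF f m], symmetric]
    by (simp add: pmf.map_comp comp_def)
qed

text \<open>The true failure probability of \<open>D\<close> is kept because its bound is strict
  while that of \<open>E\<close> is not. As \<open>err f\<close> does not depend on the message,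
  averaging over messages with \<open>\<le>\<close> still leaves a strict bound by
  \<open>\<delta>\<close>.\<close>

definition err :: "(bool list \<Rightarrow> bool) \<Rightarrow> real" where
  "err f = measure_pmf.prob (output_of n f [] (\<epsilon> / 6) (\<delta> / 2) D) {A. \<bar>class_dist n f H - A 0\<bar> > \<epsilon> / 6}
     + \<delta> / 2"

lemma err_less: "f \<in> bool_funs n \<Longrightarrow> err f < \<delta>"
  using D(1) by (auto simp: err_def distance_estimator_def)

lemma err_nonneg: "0 \<le> err f"
  using pos by (simp add: err_def)

lemma prob_bad_estimates:
  assumes "f \<in> bool_funs n" "m \<in> messages"
  shows "measure_pmf.prob (pair_pmf (output_of n f [] (\<epsilon> / 6) (\<delta> / 2) D) (output_of n f m (\<epsilon> / 6) (\<delta> / 2) E))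
    {(A, B). A \<in> {A. \<bar>class_dist n f H - A 0\<bar> > \<epsilon> / 6} \<or>
      B \<in> - {B. \<bar>fdist n f (dec m) - B 0\<bar> \<le> \<epsilon> / 6}} \<le> err f"
proof -
  have "measure_pmf.prob (output_of n f m (\<epsilon> / 6) (\<delta> / 2) E)
      (- {B. \<bar>fdist n f (dec m) - B 0\<bar> \<le> \<epsilon> / 6}) \<le> \<delta> / 2"
    using E(1) assms unfolding hypothesis_distance_estimator_def prob_Compl_pmf by fastforce
  then show ?thesis
    unfolding err_def by (intro order_trans[OF prob_pair_pmf_le]) simp
qed

text \<open>With both estimates accurate, \<open>B 0 \<le> fdist n f (dec m) + \<epsilon> / 6 \<le>
  class_dist n f H + \<epsilon> / 2 \<le> A 0 + 2 * \<epsilon> / 3\<close>, so rejection forces a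
  bad estimate.\<close>

lemma prob_reject:
  assumes "f \<in> bool_funs n" "m \<in> messages" "fdist n f (dec m) \<le> class_dist n f H + \<epsilon> / 3"
  shows "measure_pmf.prob (accept f m) {False} \<le> err f"
  unfolding accept_def measure_map_pmf
  by (rule order_trans[OF measure_pmf.finite_measure_mono prob_bad_estimates[OF assms(1,2)]])
    (use assms(3) in \<open>auto simp: abs_if not_less not_le split: if_splits\<close>)

text \<open>With both estimates accurate, \<open>B 0 \<ge> fdist n f (dec m) - \<epsilon> / 6 >
  class_dist n f H + 5 * \<epsilon> / 6 \<ge> A 0 + 2 * \<epsilon> / 3\<close>, so acceptance forces
  a bad estimate.\<close>

lemma prob_accept:
  assumes "f \<in> bool_funs n" "m \<in> messages" "fdist n f (dec m) > class_dist n f H + \<epsilon>"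
  shows "measure_pmf.prob (accept f m) {True} \<le> err f"
  unfolding accept_def measure_map_pmf
  by (rule order_trans[OF measure_pmf.finite_measure_mono prob_bad_estimates[OF assms(1,2)]])
    (use assms(3) in \<open>auto simp: abs_if not_less not_le split: if_splits\<close>)

lemma interaction_output:
  assumes "prover n (code_length H) P" "f \<in> bool_funs n"
  shows "set_pmf (interaction n dec \<epsilon> \<delta> V P f) \<subseteq> insert None (Some ` H)"
  using assms H(3) unfolding interaction_def prover_def represents_def by (auto split: if_splits)

text \<open>A prover merely chooses a distribution on messages, and each single message leads to a
  bad output with probability at most \<open>err f\<close>. Hence the exceptional set in
  \<open>prob_bind_pmf_le\<close> can be empty.\<close>

lemma soundness:
  assumes "prover n (code_length H) P" and f: "f \<in> bool_funs n"
  shows "measure_pmf.prob (interaction n dec \<epsilon> \<delta> V P f)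
    {r. \<exists>h. r = Some h \<and> fdist n f h > class_dist n f H + \<epsilon>} < \<delta>" (is "measure_pmf.prob _ ?B < _")
proof -
  have P: "set_pmf (P f) \<subseteq> messages" using assms by (simp add: prover_def)
  have "measure_pmf.prob (interaction n dec \<epsilon> \<delta> V P f) ?B \<le> measure_pmf.prob (P f) {} + err f"
    unfolding interaction_eq[of f P, OF f P]
  proof (rule prob_bind_pmf_le[OF err_nonneg])
    fix m assume m: "m \<in> set_pmf (P f)"
    show "measure_pmf.prob (map_pmf (\<lambda>b. if b then Some (dec m) else None) (accept f m)) ?B \<le> err f"
    proof (cases "fdist n f (dec m) > class_dist n f H + \<epsilon>")
      case True
      then have "(\<lambda>b. if b then Some (dec m) else None) -` ?B = {True}" by (auto split: if_splits)
      then show ?thesis using prob_accept[OF f _ True] m P by auto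
    next
      case False
      then have "(\<lambda>b. if b then Some (dec m) else None) -` ?B = {}" by (auto split: if_splits)
      then show ?thesis using err_nonneg by simp
    qed
  qed
  with err_less[OF f] show ?thesis by simp
qed

text \<open>Failure means that the learner misses its accuracy, with probability at most
  \<open>\<eta>\<close>, or that a good hypothesis is rejected, with probability at most
  \<open>err f\<close>.\<close>

lemma completeness:
  assumes L: "learning_algorithm n H dec (\<epsilon> / 3) \<eta> L" and f: "f \<in> bool_funs n"
  shows "measure_pmf.prob (interaction n dec \<epsilon> \<delta> V (learner_output n H (\<epsilon> / 3) \<eta> L) f)
    {r. \<exists>h. r = Some h \<and> fdist n f h \<le> class_dist n f H + \<epsilon> / 3} \<ge> 1 - \<delta> - \<eta>"
    (is "measure_pmf.prob ?I ?G \<ge> _")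
proof -
  let ?P = "learner_output n H (\<epsilon> / 3) \<eta> L"
  let ?M = "{m. fdist n f (dec m) \<le> class_dist n f H + \<epsilon> / 3}"
  have P: "set_pmf (?P f) \<subseteq> messages"
    by (auto simp: learner_output_def read_bits_def cube_def)
  have "measure_pmf.prob ?I (- ?G) \<le> measure_pmf.prob (?P f) (- ?M) + err f"
    unfolding interaction_eq[of f ?P, OF f P]
  proof (rule prob_bind_pmf_le[OF err_nonneg])
    fix m assume m: "m \<in> set_pmf (?P f)" "m \<notin> - ?M"
    then have "(\<lambda>b. if b then Some (dec m) else None) -` (- ?G) = {False}" by (auto split: if_splits)
    then show "measure_pmf.prob (map_pmf (\<lambda>b. if b then Some (dec m) else None) (accept f m)) (- ?G) \<le> err f"
      using prob_reject[OF f, of m] m P by auto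
  qed
  moreover have "measure_pmf.prob (?P f) ?M \<ge> 1 - \<eta>"
    using L f by (simp add: learning_algorithm_def)
  ultimately show ?thesis
    using err_less[OF f] by (simp add: prob_Compl_pmf)
qed

end

text \<open>The order of quantifiers expresses uniformity: \<open>V\<close> depends only on the
  programs \<open>D\<close> and \<open>E\<close> and reads dimension and parameters from memory, and
  \<open>c\<close> is an absolute constant. Completeness is given for some error-free learner, and
  for every learner at the cost of its failure probability \<open>\<eta>\<close>.\<close>

theorem theorem3p1:
  "\<exists>c :: nat. \<forall>D E. \<exists>V. \<forall>n H dec (q :: real \<Rightarrow> real \<Rightarrow> nat) T_D T_dist \<epsilon> \<delta>.
     \<epsilon> > 0 \<and> \<delta> > 0 \<and>
     H \<subseteq> bool_funs n \<and> H \<noteq> {} \<and> represents dec H \<and>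
     distance_estimator n H (\<epsilon> / 6) (\<delta> / 2) D \<and>
     queries_le n {[]} (\<epsilon> / 6) (\<delta> / 2) D (q (\<epsilon> / 6) (\<delta> / 2)) \<and>
     time_le n {[]} (\<epsilon> / 6) (\<delta> / 2) D (T_D (\<epsilon> / 6) (\<delta> / 2)) \<and>
     hypothesis_distance_estimator n H dec (\<epsilon> / 6) (\<delta> / 2) E \<and>
     time_le n (cube (code_length H)) (\<epsilon> / 6) (\<delta> / 2) E (T_dist (\<epsilon> / 6) (\<delta> / 2)) \<longrightarrow>
     \<comment> \<open>resources of the verifier, which receives a single message of \<open>code_length H\<close> bits\<close>
     queries_le n (cube (code_length H)) \<epsilon> \<delta> V (q (\<epsilon> / 6) (\<delta> / 2)) \<and>
     time_le n (cube (code_length H)) \<epsilon> \<delta> V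
       (T_D (\<epsilon> / 6) (\<delta> / 2) + T_dist (\<epsilon> / 6) (\<delta> / 2) + c) \<and>
     \<comment> \<open>output in \<open>H\<close> or rejection\<close>
     (\<forall>P. prover n (code_length H) P \<longrightarrow>
        (\<forall>f\<in>bool_funs n. set_pmf (interaction n dec \<epsilon> \<delta> V P f) \<subseteq> insert None (Some ` H))) \<and>
     \<comment> \<open>completeness: the honest prover runs a learning algorithm and sends its output\<close>
     (\<exists>L. learning_algorithm n H dec (\<epsilon> / 3) 0 L \<and>
        (\<forall>f\<in>bool_funs n.
           measure_pmf.prob (interaction n dec \<epsilon> \<delta> V (learner_output n H (\<epsilon> / 3) 0 L) f)
             {r. \<exists>h. r = Some h \<and> fdist n f h \<le> class_dist n f H + \<epsilon> / 3} \<ge> 1 - \<delta>)) \<and>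
     (\<forall>L \<eta>. 0 \<le> \<eta> \<and> learning_algorithm n H dec (\<epsilon> / 3) \<eta> L \<longrightarrow>
        (\<forall>f\<in>bool_funs n.
           measure_pmf.prob (interaction n dec \<epsilon> \<delta> V (learner_output n H (\<epsilon> / 3) \<eta> L) f)
             {r. \<exists>h. r = Some h \<and> fdist n f h \<le> class_dist n f H + \<epsilon> / 3} \<ge> 1 - \<delta> - \<eta>)) \<and>
     \<comment> \<open>soundness against arbitrary provers\<close>
     (\<forall>P. prover n (code_length H) P \<longrightarrow>
        (\<forall>f\<in>bool_funs n.
           measure_pmf.prob (interaction n dec \<epsilon> \<delta> V P f)
             {r. \<exists>h. r = Some h \<and> fdist n f h > class_dist n f H + \<epsilon>} < \<delta>))"
proof (rule exI[of _ 26], intro allI, rule exI[of _ "verifier _ _"], intro allI impI)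
  fix D E n H dec and q T_D T_dist :: "real \<Rightarrow> real \<Rightarrow> nat" and \<epsilon> \<delta> :: real
  assume hyps: "\<epsilon> > 0 \<and> \<delta> > 0 \<and>
     H \<subseteq> bool_funs n \<and> H \<noteq> {} \<and> represents dec H \<and>
     distance_estimator n H (\<epsilon> / 6) (\<delta> / 2) D \<and>
     queries_le n {[]} (\<epsilon> / 6) (\<delta> / 2) D (q (\<epsilon> / 6) (\<delta> / 2)) \<and>
     time_le n {[]} (\<epsilon> / 6) (\<delta> / 2) D (T_D (\<epsilon> / 6) (\<delta> / 2)) \<and>
     hypothesis_distance_estimator n H dec (\<epsilon> / 6) (\<delta> / 2) E \<and>
     time_le n (cube (code_length H)) (\<epsilon> / 6) (\<delta> / 2) E (T_dist (\<epsilon> / 6) (\<delta> / 2))"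
  then interpret estimators n H dec \<epsilon> \<delta> D E "q (\<epsilon> / 6) (\<delta> / 2)" "T_D (\<epsilon> / 6) (\<delta> / 2)"
    "T_dist (\<epsilon> / 6) (\<delta> / 2)"
    by unfold_locales auto
  obtain L where "learning_algorithm n H dec (\<epsilon> / 3) 0 L"
    using exact_learner_exists[OF H, of "\<epsilon> / 3"] pos by auto
  \<comment> \<open>For an error-free learner, \<open>\<eta> = 0\<close> turns
    \<open>1 - \<delta> - \<eta>\<close> into the required \<open>1 - \<delta>\<close>.\<close>
  then have honest: "\<exists>L. learning_algorithm n H dec (\<epsilon> / 3) 0 L \<and>
      (\<forall>f\<in>bool_funs n.
         measure_pmf.prob (interaction n dec \<epsilon> \<delta> V (learner_output n H (\<epsilon> / 3) 0 L) f)
           {r. \<exists>h. r = Some h \<and> fdist n f h \<le> class_dist n f H + \<epsilon> / 3} \<ge> 1 - \<delta>)"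
    using completeness by fastforce
  show "queries_le n messages \<epsilon> \<delta> V (q (\<epsilon> / 6) (\<delta> / 2)) \<and>
     time_le n messages \<epsilon> \<delta> V (T_D (\<epsilon> / 6) (\<delta> / 2) + T_dist (\<epsilon> / 6) (\<delta> / 2) + 26) \<and>
     (\<forall>P. prover n (code_length H) P \<longrightarrow>
        (\<forall>f\<in>bool_funs n. set_pmf (interaction n dec \<epsilon> \<delta> V P f) \<subseteq> insert None (Some ` H))) \<and>
     (\<exists>L. learning_algorithm n H dec (\<epsilon> / 3) 0 L \<and>
        (\<forall>f\<in>bool_funs n.
           measure_pmf.prob (interaction n dec \<epsilon> \<delta> V (learner_output n H (\<epsilon> / 3) 0 L) f)
             {r. \<exists>h. r = Some h \<and> fdist n f h \<le> class_dist n f H + \<epsilon> / 3} \<ge> 1 - \<delta>)) \<and>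
     (\<forall>L \<eta>. 0 \<le> \<eta> \<and> learning_algorithm n H dec (\<epsilon> / 3) \<eta> L \<longrightarrow>
        (\<forall>f\<in>bool_funs n.
           measure_pmf.prob (interaction n dec \<epsilon> \<delta> V (learner_output n H (\<epsilon> / 3) \<eta> L) f)
             {r. \<exists>h. r = Some h \<and> fdist n f h \<le> class_dist n f H + \<epsilon> / 3} \<ge> 1 - \<delta> - \<eta>)) \<and>
     (\<forall>P. prover n (code_length H) P \<longrightarrow>
        (\<forall>f\<in>bool_funs n.
           measure_pmf.prob (interaction n dec \<epsilon> \<delta> V P f)
             {r. \<exists>h. r = Some h \<and> fdist n f h > class_dist n f H + \<epsilon>} < \<delta>))"
    using queries_verifier time_verifier interaction_output honest completeness soundness by blast
qed

end
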